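(* Let $\mathfrak m$ be a $\mathbb K$-module, $k\ge 2$ an integer such that $2,3,\ldots,k-1$ are invertible in $\mathbb K$, and let $(\mathcal X^+,\mathcal X^-)$ be the linear pair geometry $(\mathcal F_k,\mathcal F_k)$ of complemented flags of length $k$ in $\mathfrak m$, or one of its subgeometries obtained by fixing type and co-type of the flags. Let $j\in\{0,\ldots,k-1\}$ and let $\mathfrak e\subset\mathfrak m$ be a linear subspace. Then the set $$\mathcal I_{\mathfrak e;j}:=\{\mathfrak f\in\mathcal X^+ : \mathfrak f_j\subset\mathfrak e\subset\mathfrak f_{j+1}\}$$ is an intrinsic subspace of $\mathcal X^+$.
   Context: $\mathbb K$ is a commutative ring with unit $1$ in which $2$ is invertible; "linear subspace" means $\mathbb K$-submodule. A flag of length $k$ in $\mathfrak m$ is a sequence $\mathfrak f=(\mathfrak f_1,\ldots,\mathfrak f_k)$ of linear subspaces with $0\subset\mathfrak f_1\subset\cdots\subset\mathfrak f_{k-1}\subset\mathfrak f_k=\mathfrak m$, all inclusions strict; put $\mathfrak f_0=0$. Two flags $\mathfrak f,\mathfrak f'$ of length $k$ are transversal, $\mathfrak f\top\mathfrak f'$, if $\mathfrak f_i\oplus\mathfrak f'_{k-i}=\mathfrak m$ for all $i=1,\ldots,k$. A flag is complemented if it admits a transversal flag; $\mathcal F_k$ is the set of complemented flags of length $k$. Pair geometries. A linear pair geometry over $\mathbb K$ is a pair of sets $(\mathcal X^+,\mathcal X^-)$ with a relation $\top\subset\mathcal X^+\times\mathcal X^-$ such that every element of either set is transversal to some element of the other,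 and such that for every transversal pair $x\top\alpha$ the sets $\mathfrak v_\alpha=\{y\in\mathcal X^+:y\top\alpha\}$ and $\mathfrak v'_x=\{\beta\in\mathcal X^-:x\top\beta\}$ carry $\mathbb K$-module structures $(\mathfrak v_\alpha,x)$ and $(\mathfrak v'_x,\alpha)$ with zero vectors $x$ and $\alpha$ respectively. A subset $\mathcal I\subset\mathcal X^+$ is an intrinsic subspace if for all $\alpha\in\mathcal X^-$ with $\mathfrak v_\alpha\cap\mathcal I\neq\emptyset$ and all $x\in\mathfrak v_\alpha\cap\mathcal I$, the set $\mathfrak v_\alpha\cap\mathcal I$ is a linear subspace of $(\mathfrak v_\alpha,x)$. Linear structure on $(\mathcal F_k,\mathcal F_k)$. For a flag $\mathfrak f$ let $\mathfrak u(\mathfrak f)=\{X\in\mathrm{End}(\mathfrak m): X(\mathfrak f_i)\subset\mathfrak f_{i-1}\ \forall i=1,\ldots,k\}$ and $\exp(X)=\sum_{i=0}^{k-1}X^i/i!$. $\mathrm{GL}(\mathfrak m)$ acts on flags by $(g.\mathfrak e)_i=g(\mathfrak e_i)$. For a transversal pair $(\mathfrak f,\mathfrak e)$, the map $\mathfrak u(\mathfrak f)\to\mathfrak f^\top=\{\mathfrak h:\mathfrak h\top\mathfrak f\}$, $X\mapsto\exp(X).\mathfrak e$ is a bijection, and the module structure on $(\mathfrak f^\top,\mathfrak e)$ is the one making this bijection linear. Fixing type and co-type. Let $\mathfrak o\top\mathfrak o'$ be transversal flags of length $k$. Write $\mathfrak f\cong\mathfrak e$ if $\mathfrak f_j$ and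 $\mathfrak e_j$ are isomorphic $\mathbb K$-modules for all $j$. The subgeometry is $\mathcal X^+=\{\mathfrak f\in\mathcal F_k:\mathfrak f\cong\mathfrak o,\ \exists\,\mathfrak f'\cong\mathfrak o'\text{ with }\mathfrak f'\top\mathfrak f\}$, $\mathcal X^-=\{\mathfrak f\in\mathcal F_k:\mathfrak f\cong\mathfrak o',\ \exists\,\mathfrak f'\cong\mathfrak o\text{ with }\mathfrak f'\top\mathfrak f\}$, with the induced transversality and module structures (for $\alpha\in\mathcal X^-$ the whole set $\alpha^\top$ lies in $\mathcal X^+$, and dually). *)

theory Defs
  imports Complex_Main
begin

section \<open>Pair geometries\<close>

text \<open>
  The data of a linear pair geometry: \<open>point_add G \<alpha> x\<close> and \<open>point_smult G \<alpha> x\<close> are the operations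
  of the module \<open>(v\<^sub>\<alpha>, x)\<close> with zero vector \<open>x\<close>, and \<open>copoint_add G x \<alpha>\<close>, \<open>copoint_smult G x \<alpha>\<close> those of
  \<open>(v'\<^sub>x, \<alpha>)\<close>. They are only meaningful when \<open>x\<close> and \<open>\<alpha>\<close> are transversal. The axioms are
  not part of the record type.
\<close>

record ('k, 'p, 'q) pair_geometry =
  points :: "'p set"
  copoints :: "'q set"
  transv :: "'p \<Rightarrow> 'q \<Rightarrow> bool"
  point_add :: "'q \<Rightarrow> 'p \<Rightarrow> 'p \<Rightarrow> 'p \<Rightarrow> 'p"
  point_smult :: "'q \<Rightarrow> 'p \<Rightarrow> 'k \<Rightarrow> 'p \<Rightarrow> 'p"
  copoint_add :: "'p \<Rightarrow> 'q \<Rightarrow> 'q \<Rightarrow> 'q \<Rightarrow> 'q"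
  copoint_smult :: "'p \<Rightarrow> 'q \<Rightarrow> 'k \<Rightarrow> 'q \<Rightarrow> 'q"

definition affine_part :: "('k, 'p, 'q) pair_geometry \<Rightarrow> 'q \<Rightarrow> 'p set" where
  "affine_part G \<alpha> = {y \<in> points G. transv G y \<alpha>}"

definition linear_subspace_at ::
    "('k, 'p, 'q) pair_geometry \<Rightarrow> 'q \<Rightarrow> 'p \<Rightarrow> 'p set \<Rightarrow> bool" where
  "linear_subspace_at G \<alpha> x S \<longleftrightarrow>
     S \<subseteq> affine_part G \<alpha> \<and> x \<in> S \<and>
     (\<forall>y\<in>S. \<forall>z\<in>S. point_add G \<alpha> x y z \<in> S) \<and>
     (\<forall>c. \<forall>y\<in>S. point_smult G \<alpha> x c y \<in> S)"

definition intrinsic_subspace :: "('k, 'p, 'q) pair_geometry \<Rightarrow> 'p set \<Rightarrow> bool" where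
  "intrinsic_subspace G I \<longleftrightarrow>
     I \<subseteq> points G \<and>
     (\<forall>\<alpha>\<in>copoints G. affine_part G \<alpha> \<inter> I \<noteq> {} \<longrightarrow>
        (\<forall>x\<in>affine_part G \<alpha> \<inter> I. linear_subspace_at G \<alpha> x (affine_part G \<alpha> \<inter> I)))"


section \<open>Flags\<close>

text \<open>
  Throughout, \<open>s\<close> is the scalar multiplication of a module whose underlying set is the whole
  type \<open>'m\<close>. The list \<open>[f\<^sub>1, \<dots>, f\<^sub>k]\<close> represents a flag of length \<open>k\<close>; \<open>flag_at\<close> adds the
  convention \<open>f\<^sub>0 = 0\<close>.
\<close>

definition flag_at :: "'m::zero set list \<Rightarrow> nat \<Rightarrow> 'm set" where
  "flag_at f i = ({0} # f) ! i"

definition is_flag ::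
    "('k::comm_ring_1 \<Rightarrow> 'm::ab_group_add \<Rightarrow> 'm) \<Rightarrow> nat \<Rightarrow> 'm set list \<Rightarrow> bool" where
  "is_flag s k f \<longleftrightarrow>
     length f = k \<and>
     (\<forall>i\<in>{1..k}. module.subspace s (flag_at f i)) \<and>
     (\<forall>i<k. flag_at f i \<subset> flag_at f (Suc i)) \<and>
     flag_at f k = UNIV"

definition direct_sum_decomp :: "'m::ab_group_add set \<Rightarrow> 'm set \<Rightarrow> bool" where
  "direct_sum_decomp A B \<longleftrightarrow> {a + b | a b. a \<in> A \<and> b \<in> B} = UNIV \<and> A \<inter> B = {0}"

definition flag_transv :: "nat \<Rightarrow> 'm::ab_group_add set list \<Rightarrow> 'm set list \<Rightarrow> bool" where
  "flag_transv k f f' \<longleftrightarrow> (\<forall>i\<in>{1..k}. direct_sum_decomp (flag_at f i) (flag_at f' (k - i)))"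

definition complemented_flags ::
    "('k::comm_ring_1 \<Rightarrow> 'm::ab_group_add \<Rightarrow> 'm) \<Rightarrow> nat \<Rightarrow> 'm set list set" where
  "complemented_flags s k = {f. is_flag s k f \<and> (\<exists>f'. is_flag s k f' \<and> flag_transv k f f')}"


section \<open>The linear structure on flags\<close>

definition flag_nil ::
    "('k::comm_ring_1 \<Rightarrow> 'm::ab_group_add \<Rightarrow> 'm) \<Rightarrow> nat \<Rightarrow> 'm set list \<Rightarrow> ('m \<Rightarrow> 'm) set" where
  "flag_nil s k f = {X. module_hom s s X \<and> (\<forall>i\<in>{1..k}. X ` flag_at f i \<subseteq> flag_at f (i - 1))}"

text \<open>Only meaningful for units: the inverse in a commutative ring that need not be a field.\<close>

definition unit_inverse :: "'k::comm_ring_1 \<Rightarrow> 'k" where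
  "unit_inverse a = (THE b. a * b = 1)"

definition trunc_exp ::
    "('k::comm_ring_1 \<Rightarrow> 'm::ab_group_add \<Rightarrow> 'm) \<Rightarrow> nat \<Rightarrow> ('m \<Rightarrow> 'm) \<Rightarrow> 'm \<Rightarrow> 'm" where
  "trunc_exp s k X v = (\<Sum>i<k. s (unit_inverse (of_nat (fact i))) ((X ^^ i) v))"

definition flag_act :: "('m \<Rightarrow> 'm) \<Rightarrow> 'm set list \<Rightarrow> 'm set list" where
  "flag_act g e = map (\<lambda>A. g ` A) e"

text \<open>
  The chart \<open>X \<mapsto> exp(X).e\<close> is a bijection from \<open>flag_nil s k f\<close> onto the flags transversal to \<open>f\<close>
  when \<open>e\<close> is one of them and \<open>2, \<dots>, k - 1\<close> are invertible; \<open>flag_coord\<close> is its inverse. The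
  operations below transport the (pointwise) module structure of \<open>flag_nil s k f\<close> along it, so
  that \<open>e\<close> is the zero vector.
\<close>

definition flag_chart ::
    "('k::comm_ring_1 \<Rightarrow> 'm::ab_group_add \<Rightarrow> 'm) \<Rightarrow> nat \<Rightarrow> 'm set list \<Rightarrow> ('m \<Rightarrow> 'm) \<Rightarrow> 'm set list" where
  "flag_chart s k e X = flag_act (trunc_exp s k X) e"

definition flag_coord ::
    "('k::comm_ring_1 \<Rightarrow> 'm::ab_group_add \<Rightarrow> 'm) \<Rightarrow> nat \<Rightarrow>
       'm set list \<Rightarrow> 'm set list \<Rightarrow> 'm set list \<Rightarrow> 'm \<Rightarrow> 'm" where
  "flag_coord s k f e = inv_into (flag_nil s k f) (flag_chart s k e)"

definition flag_add ::
    "('k::comm_ring_1 \<Rightarrow> 'm::ab_group_add \<Rightarrow> 'm) \<Rightarrow> nat \<Rightarrow>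
       'm set list \<Rightarrow> 'm set list \<Rightarrow> 'm set list \<Rightarrow> 'm set list \<Rightarrow> 'm set list" where
  "flag_add s k f e g h =
     flag_chart s k e (\<lambda>v. flag_coord s k f e g v + flag_coord s k f e h v)"

definition flag_smult ::
    "('k::comm_ring_1 \<Rightarrow> 'm::ab_group_add \<Rightarrow> 'm) \<Rightarrow> nat \<Rightarrow>
       'm set list \<Rightarrow> 'm set list \<Rightarrow> 'k \<Rightarrow> 'm set list \<Rightarrow> 'm set list" where
  "flag_smult s k f e c h = flag_chart s k e (\<lambda>v. s c (flag_coord s k f e h v))"


section \<open>The geometry of complemented flags and its subgeometries\<close>

text \<open>Transversality of flags is symmetric, so both sides carry the same operations.\<close>

definition flag_geometry ::
    "('k::comm_ring_1 \<Rightarrow> 'm::ab_group_add \<Rightarrow> 'm) \<Rightarrow> nat \<Rightarrow>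
       ('k, 'm set list, 'm set list) pair_geometry" where
  "flag_geometry s k = \<lparr>
     points = complemented_flags s k,
     copoints = complemented_flags s k,
     transv = flag_transv k,
     point_add = flag_add s k,
     point_smult = flag_smult s k,
     copoint_add = flag_add s k,
     copoint_smult = flag_smult s k \<rparr>"

definition submodules_isomorphic ::
    "('k::comm_ring_1 \<Rightarrow> 'm::ab_group_add \<Rightarrow> 'm) \<Rightarrow> 'm set \<Rightarrow> 'm set \<Rightarrow> bool" where
  "submodules_isomorphic s A B \<longleftrightarrow>
     (\<exists>\<phi>. bij_betw \<phi> A B \<and>
        (\<forall>x\<in>A. \<forall>y\<in>A. \<phi> (x + y) = \<phi> x + \<phi> y) \<and>
        (\<forall>c. \<forall>x\<in>A. \<phi> (s c x) = s c (\<phi> x)))"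

definition same_type ::
    "('k::comm_ring_1 \<Rightarrow> 'm::ab_group_add \<Rightarrow> 'm) \<Rightarrow> nat \<Rightarrow> 'm set list \<Rightarrow> 'm set list \<Rightarrow> bool" where
  "same_type s k f e \<longleftrightarrow> (\<forall>j\<in>{1..k}. submodules_isomorphic s (flag_at f j) (flag_at e j))"

definition flags_of_type ::
    "('k::comm_ring_1 \<Rightarrow> 'm::ab_group_add \<Rightarrow> 'm) \<Rightarrow> nat \<Rightarrow> 'm set list \<Rightarrow> 'm set list \<Rightarrow> 'm set list set" where
  "flags_of_type s k b b' =
     {f \<in> complemented_flags s k. same_type s k f b \<and>
        (\<exists>f'. is_flag s k f' \<and> same_type s k f' b' \<and> flag_transv k f' f)}"

definition flag_subgeometry ::
    "('k::comm_ring_1 \<Rightarrow> 'm::ab_group_add \<Rightarrow> 'm) \<Rightarrow> nat \<Rightarrow> 'm set list \<Rightarrow> 'm set list \<Rightarrow>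
       ('k, 'm set list, 'm set list) pair_geometry" where
  "flag_subgeometry s k b b' = (flag_geometry s k) \<lparr>
     points := flags_of_type s k b b',
     copoints := flags_of_type s k b' b \<rparr>"

definition flags_around ::
    "('k, 'm::zero set list, 'q) pair_geometry \<Rightarrow> 'm set \<Rightarrow> nat \<Rightarrow> 'm set list set" where
  "flags_around G E j = {f \<in> points G. flag_at f j \<subseteq> E \<and> E \<subseteq> flag_at f (j + 1)}"

end

theory Submission
  imports Defs "HOL-Computational_Algebra.Polynomial"
begin

text \<open>
  Put \<open>g = exp(X)\<close> for \<open>X\<close> in \<open>u(\<alpha>)\<close>, where \<open>\<alpha>\<close> is transversal to the base point \<open>e\<close> of the
  intrinsic subspace. Then \<open>g.e\<close> satisfies \<open>g e\<^sub>j \<subseteq> E \<subseteq> g e\<^sub>j\<^sub>+\<^sub>1\<close> if and only if \<open>X E \<subseteq> E\<close>, which is a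
  linear condition on \<open>X\<close>. If \<open>X E \<subseteq> E\<close>, then \<open>g E = E\<close> because \<open>g\<close> is unipotent, so \<open>g\<close> carries
  \<open>e\<^sub>j \<subseteq> E \<subseteq> e\<^sub>j\<^sub>+\<^sub>1\<close> to the required inclusions. Conversely, \<open>E\<close> is the sum of \<open>e\<^sub>j\<close> and
  \<open>E \<inter> \<alpha>\<^sub>k\<^sub>-\<^sub>j\<close>; the inclusions force \<open>g\<close> to map the first summand into \<open>E\<close> and to fix the second
  one pointwise, so \<open>g - 1\<close> preserves \<open>E\<close>, and \<open>X\<close> is a polynomial in \<open>g - 1\<close>.

  Every flag \<open>h\<close> transversal to \<open>\<alpha>\<close> arises in this way: if \<open>P\<^sub>i\<close> and \<open>P'\<^sub>i\<close> are the projections along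
  \<open>\<alpha>\<^sub>k\<^sub>-\<^sub>i\<close> onto \<open>e\<^sub>i\<close> and \<open>h\<^sub>i\<close>, the unipotent map \<open>g = \<Sum>\<^sub>i P'\<^sub>i (P\<^sub>i - P\<^sub>i\<^sub>-\<^sub>1)\<close> takes \<open>e\<close> to \<open>h\<close>, and it is
  the exponential of a polynomial in \<open>g - 1\<close>. Compositional inverses modulo \<open>x\<^sup>k\<close> play the part of
  the logarithm in both arguments.
\<close>

section \<open>Polynomials modulo a power of the indeterminate\<close>

lemma X_dvd_iff_coeff_0: "[:0, 1:] dvd p \<longleftrightarrow> coeff p 0 = 0"
  for p :: "'a::comm_ring_1 poly"
  by (simp add: dvd_iff_poly_eq_0 [of 0, simplified] poly_0_coeff_0)

lemma pCons_conv_X_mult: "pCons a p = [:a:] + [:0, 1:] * p"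
  for p :: "'a::comm_ring_1 poly"
  by simp

text \<open>The factor theorem for \<open>r\<close>, by Horner's scheme. It controls how a composite
  reacts to a change of its inner polynomial.\<close>

lemma diff_dvd_pcompose_diff: "p - q dvd pcompose r p - pcompose r q"
  for p q r :: "'a::comm_ring_1 poly"
proof (induction r)
  case (pCons a r)
  have "pcompose (pCons a r) p - pcompose (pCons a r) q
      = (p - q) * pcompose r p + q * (pcompose r p - pcompose r q)"
    by (simp add: pcompose_pCons algebra_simps)
  with pCons.IH show ?case
    by simp
qed simp

text \<open>Since \<open>1 - p\<close> has constant term 0, the geometric series in
  \<open>1 - p\<close> cut off at \<open>n\<close> inverts \<open>p\<close> modulo x^n.\<close>

lemma unipotent_poly_inverse_mod:
  fixes p :: "'a::comm_ring_1 poly"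
  assumes "coeff p 0 = 1"
  obtains q where "[:0, 1:] ^ n dvd q * p - 1"
proof
  have "coeff (1 - p) 0 = 0"
    using assms by simp
  then have "[:0, 1:] ^ n dvd (1 - p) ^ n"
    by (simp only: X_dvd_iff_coeff_0 [symmetric] dvd_power_same)
  moreover have "(\<Sum>i<n. (1 - p) ^ i) * p - 1 = - ((1 - p) ^ n)"
    using one_diff_power_eq [of "1 - p" n] by (simp add: algebra_simps)
  ultimately show "[:0, 1:] ^ n dvd (\<Sum>i<n. (1 - p) ^ i) * p - 1"
    by simp
qed

text \<open>If \<open>p\<close> works modulo x^n with error c x^n + ..., subtracting c x^n from
  \<open>p\<close> removes the leading error, because u^n has constant term 1 and so f^n = x^n
  modulo x^(n+1). No division occurs, so any commutative ring will do.\<close>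

lemma poly_left_compositional_inverse_mod:
  fixes f :: "'a::comm_ring_1 poly"
  assumes f: "f = [:0, 1:] * u" and u: "coeff u 0 = 1"
  shows "\<exists>p. [:0, 1:] ^ n dvd pcompose p f - [:0, 1:]"
proof (induction n)
  case (Suc n)
  then obtain p q where "pcompose p f - [:0, 1:] = [:0, 1:] ^ n * q"
    by (auto elim: dvdE)
  moreover obtain c q' where "q = [:c:] + [:0, 1:] * q'"
    by (metis pCons_cases pCons_conv_X_mult)
  ultimately have p: "pcompose p f = [:0, 1:] + [:0, 1:] ^ n * ([:c:] + [:0, 1:] * q')"
    by (simp only: diff_eq_eq add.commute)
  have "coeff (u ^ n - 1) 0 = 0"
    using u by (simp add: coeff_0_power)
  then obtain t where "u ^ n - 1 = [:0, 1:] * t"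
    unfolding X_dvd_iff_coeff_0 [symmetric] by (elim dvdE)
  then have un: "u ^ n = 1 + [:0, 1:] * t"
    by (simp only: diff_eq_eq add.commute)
  have "pcompose ([:0, 1:] ^ n) f = f ^ n"
    by (induction n) (simp_all add: pcompose_mult pcompose_pCons pcompose_1)
  then have "pcompose (p - [:c:] * [:0, 1:] ^ n) f = pcompose p f - [:c:] * f ^ n"
    by (simp only: pcompose_diff pcompose_mult pcompose_const)
  moreover have "f ^ n = [:0, 1:] ^ n * (1 + [:0, 1:] * t)"
    by (simp only: f power_mult_distrib un)
  ultimately have "pcompose (p - [:c:] * [:0, 1:] ^ n) f - [:0, 1:]
      = [:0, 1:] ^ Suc n * (q' - [:c:] * t)"
    by (simp only: p power_Suc) (simp only: algebra_simps mult_1_left)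
  then show ?case
    by (metis dvd_triv_left)
qed simp

text \<open>Writing f(h) = h + h^2 r(h), replacing \<open>p\<close> by p - c x^n changes f(p) by -c
  x^n up to a multiple of x^(n+1), which removes the leading error. Divisibility of \<open>p\<close>
  by x is carried through the induction to make the quadratic term small.\<close>

lemma poly_right_compositional_inverse_mod:
  fixes f :: "'a::comm_ring_1 poly"
  assumes f: "f = [:0, 1:] * u" and u: "coeff u 0 = 1"
  shows "\<exists>p. [:0, 1:] dvd p \<and> [:0, 1:] ^ n dvd pcompose f p - [:0, 1:]"
proof (induction n)
  case 0
  show ?case by (intro exI [of _ 0]) simp
next
  case (Suc n)
  \<comment> \<open>At \<open>n = 0\<close> the correction c x^n would be a constant and destroy
    divisibility by x, so 0 is used instead.\<close>
  show ?case
  proof (cases "n = 0")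
    case True
    have "pcompose f 0 = 0"
      using f by (simp add: pcompose_mult pcompose_pCons)
    then show ?thesis
      using True by (intro exI [of _ 0]) (simp add: X_dvd_iff_coeff_0)
  next
    case False
    from Suc obtain p q where xp: "[:0, 1:] dvd p" and "pcompose f p - [:0, 1:] = [:0, 1:] ^ n * q"
      by (auto elim: dvdE)
    moreover obtain c q' where "q = [:c:] + [:0, 1:] * q'"
      by (metis pCons_cases pCons_conv_X_mult)
    ultimately have p: "pcompose f p = [:0, 1:] + [:0, 1:] ^ n * ([:c:] + [:0, 1:] * q')"
      by (simp only: diff_eq_eq add.commute)
    define p1 where "p1 = p - [:c:] * [:0, 1:] ^ n"
    have xp1: "[:0, 1:] dvd p1"
      unfolding p1_def using xp False by (intro dvd_diff dvd_mult dvd_power) auto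
    have "coeff (u - 1) 0 = 0"
      using u by simp
    then obtain r where "u - 1 = [:0, 1:] * r"
      unfolding X_dvd_iff_coeff_0 [symmetric] by (elim dvdE)
    then have u': "u = 1 + [:0, 1:] * r"
      by (simp only: diff_eq_eq add.commute)
    have comp: "pcompose f h = h + h * h * pcompose r h" for h
      by (simp only: f u' pcompose_mult pcompose_add pcompose_1 pcompose_idR)
        (simp add: pcompose_pCons algebra_simps)
    obtain t where t: "pcompose r p1 - pcompose r p = (p1 - p) * t"
      using diff_dvd_pcompose_diff [of p1 p r] by (elim dvdE)
    \<comment> \<open>As x divides both \<open>p\<close> and \<open>p1\<close>, it divides
      \<open>d\<close>; hence \<open>(p1 - p) * d\<close> has order at least
      \<open>n + 1\<close>.\<close>
    define d where "d = p1 * p1 * t + (p1 + p) * pcompose r p"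
    define d where "d = p1 * p1 * t + (p1 + p) * pcompose r p"
    have "pcompose f p1 - pcompose f p - (p1 - p)
        = p1 * p1 * (pcompose r p1 - pcompose r p) + (p1 - p) * (p1 + p) * pcompose r p"
      by (simp add: comp algebra_simps)
    also have "\<dots> = (p1 - p) * d"
      by (simp only: t d_def) (simp only: algebra_simps)
    finally have "pcompose f p1 - [:0, 1:] = (pcompose f p - [:0, 1:]) + (p1 - p) + (p1 - p) * d"
      by (simp add: algebra_simps)
    also have "p1 - p = - ([:c:] * [:0, 1:] ^ n)"
      by (simp add: p1_def)
    also have "pcompose f p - [:0, 1:] + - ([:c:] * [:0, 1:] ^ n) + - ([:c:] * [:0, 1:] ^ n) * d
        = [:0, 1:] ^ Suc n * q' - [:c:] * ([:0, 1:] ^ n * d)"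
      by (simp only: p power_Suc) (simp only: algebra_simps mult_minus_right add_minus_cancel minus_add_cancel)
    finally have "pcompose f p1 - [:0, 1:] = [:0, 1:] ^ Suc n * q' - [:c:] * ([:0, 1:] ^ n * d)" .
    moreover have "[:0, 1:] ^ n * [:0, 1:] dvd [:0, 1:] ^ n * d"
      unfolding d_def using xp xp1 by (intro mult_dvd_mono dvd_add dvd_mult2) auto
    ultimately have "[:0, 1:] ^ Suc n dvd pcompose f p1 - [:0, 1:]"
      by (simp only: power_Suc2) (simp only: dvd_diff dvd_mult dvd_triv_left)
    with xp1 show ?thesis by blast
  qed
qed

section \<open>Polynomials in an endomorphism\<close>

text \<open>Horner evaluation of \<open>p\<close> at the endomorphism \<open>X\<close>, applied to
  \<open>v\<close>. For linear \<open>X\<close> it is the action of k[x] in which x acts as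
  \<open>X\<close>.\<close>

definition poly_act :: "('k::comm_ring_1 \<Rightarrow> 'm::ab_group_add \<Rightarrow> 'm) \<Rightarrow> ('m \<Rightarrow> 'm) \<Rightarrow> 'k poly \<Rightarrow> 'm \<Rightarrow> 'm"
  where "poly_act s X p v = fold_coeffs (\<lambda>a w. s a v + X w) p 0"

lemma poly_act_0 [simp]: "poly_act s X 0 v = 0"
  by (simp add: poly_act_def)

context
  fixes s :: "'k::comm_ring_1 \<Rightarrow> 'm::ab_group_add \<Rightarrow> 'm" and X :: "'m \<Rightarrow> 'm"
  assumes X: "module_hom s s X"
begin

interpretation module_hom s s X by (fact X)

lemma poly_act_pCons: "poly_act s X (pCons a p) v = s a v + X (poly_act s X p v)"
  \<comment> \<open>\<open>pCons 0 0\<close> is the zero polynomial, whose coefficient list is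
    empty, so the fold treats it separately.\<close>
  by (cases "a = 0 \<and> p = 0") (auto simp: poly_act_def zero m1.scale_zero_left)

lemma poly_act_const: "poly_act s X [:a:] v = s a v"
  by (simp add: poly_act_pCons zero)

lemma poly_act_1: "poly_act s X 1 v = v"
  by (simp add: one_pCons poly_act_const m1.scale_one)

lemma poly_act_X: "poly_act s X [:0, 1:] v = X v"
  by (simp add: poly_act_pCons zero)

lemma poly_act_smult: "poly_act s X (smult a p) v = s a (poly_act s X p v)"
  by (induction p) (simp_all add: poly_act_pCons m1.scale_right_distrib scale)

lemma poly_act_add: "poly_act s X (p + q) v = poly_act s X p v + poly_act s X q v"
proof (induction p q rule: poly_induct2)
  case (pCons a p b q)
  then show ?case
    by (simp add: poly_act_pCons add m1.scale_left_distrib algebra_simps)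
qed simp

lemma poly_act_diff: "poly_act s X (p - q) v = poly_act s X p v - poly_act s X q v"
  using poly_act_add [of "p - q" q v] by (simp add: algebra_simps)

lemma poly_act_mult: "poly_act s X (p * q) v = poly_act s X p (poly_act s X q v)"
  by (induction p) (simp_all add: poly_act_pCons poly_act_add poly_act_smult mult_pCons_left)

lemma poly_act_power: "poly_act s X (p ^ n) v = (poly_act s X p ^^ n) v"
  by (induction n) (simp_all add: poly_act_1 poly_act_mult)

lemma poly_act_sum: "poly_act s X (\<Sum>i\<in>A. p i) v = (\<Sum>i\<in>A. poly_act s X (p i) v)"
  by (induction A rule: infinite_finite_induct) (simp_all add: poly_act_add)

lemma module_hom_poly_act: "module_hom s s (poly_act s X p)"
proof unfold_locales
  show "poly_act s X p (v + w) = poly_act s X p v + poly_act s X p w" for v w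
    by (induction p) (simp_all add: poly_act_pCons add m1.scale_right_distrib algebra_simps)
  show "poly_act s X p (s r v) = s r (poly_act s X p v)" for r v
    by (induction p) (simp_all add: poly_act_pCons scale m1.scale_right_distrib mult.commute)
qed

lemma poly_act_in_subspace:
  assumes "m1.subspace E" "X ` E \<subseteq> E" "v \<in> E"
  shows "poly_act s X p v \<in> E"
  using assms
  by (induction p)
    (auto simp: poly_act_pCons m1.subspace_0 intro!: m1.subspace_add m1.subspace_scale)

text \<open>A multiple of x^n acts as r(X) X^n = 0. Congruences of polynomials thus become
  identities of endomorphisms.\<close>

lemma poly_act_cong_mod:
  assumes "X ^^ n = (\<lambda>v. 0)" "[:0, 1:] ^ n dvd p - q"
  shows "poly_act s X p = poly_act s X q"
proof
  fix v
  obtain r where "p - q = r * [:0, 1:] ^ n"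
    using assms(2) by (metis dvdE mult.commute)
  then have "poly_act s X (p - q) v = poly_act s X r ((X ^^ n) v)"
    by (simp only: poly_act_mult poly_act_power poly_act_X [abs_def])
  also have "\<dots> = 0"
    unfolding assms(1) by (rule module_hom.zero [OF module_hom_poly_act])
  finally show "poly_act s X p v = poly_act s X q v"
    by (simp add: poly_act_diff)
qed

end

text \<open>Carries compositional inverses of polynomials over to endomorphisms.\<close>

lemma poly_act_pcompose:
  assumes "module_hom s s X"
  shows "poly_act s X (pcompose p q) v = poly_act s (poly_act s X q) p v"
  using assms
  by (induction p)
    (simp_all add: pcompose_pCons poly_act_pCons module_hom_poly_act poly_act_add poly_act_mult poly_act_const module_hom.zero)

section \<open>The truncated exponential as a polynomial\<close>

definition exp_poly :: "nat \<Rightarrow> 'k::comm_ring_1 poly" where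
  "exp_poly k = (\<Sum>i<k. monom (unit_inverse (of_nat (fact i))) i)"

lemma unit_inverse_1 [simp]: "unit_inverse 1 = 1"
  by (simp add: unit_inverse_def)

text \<open>The coefficients in degrees 0 and 1 are both \<open>unit_inverse 1\<close>, and
  \<open>k \<ge> 2\<close> keeps degree 1 in the sum. So \<open>exp_poly k - 1\<close> has
  compositional inverses modulo every power of x.\<close>

lemma exp_poly_eq:
  assumes "k \<ge> 2"
  obtains u where "exp_poly k - 1 = [:0, 1:] * u" "coeff u 0 = (1 :: 'k::comm_ring_1)"
proof -
  have c: "coeff (exp_poly k) i = (if i < k then unit_inverse (of_nat (fact i)) else (0::'k))" for i
    by (simp add: exp_poly_def coeff_sum coeff_monom)
  have "coeff (exp_poly k - 1 :: 'k poly) 0 = 0"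
    using assms by (simp add: c)
  then obtain u :: "'k poly" where u: "exp_poly k - 1 = [:0, 1:] * u"
    unfolding X_dvd_iff_coeff_0 [symmetric] by (elim dvdE)
  have "coeff u 0 = coeff ([:0, 1:] * u) 1"
    by simp
  also have "\<dots> = 1"
    unfolding u [symmetric] using assms by (simp add: c)
  finally show ?thesis
    using u that by blast
qed

lemma trunc_exp_conv_poly_act:
  assumes "module_hom s s X"
  shows "trunc_exp s k X = poly_act s X (exp_poly k)"
proof
  interpret module_hom s s X by fact
  have "poly_act s X (monom a i) v = s a ((X ^^ i) v)" for a i v
    by (induction i)
      (simp_all add: assms poly_act_pCons monom_Suc monom_0 zero m1.scale_zero_left scale)
  then show "trunc_exp s k X v = poly_act s X (exp_poly k) v" for v
    by (simp add: trunc_exp_def exp_poly_def poly_act_sum assms)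
qed

text \<open>The inverse is again a polynomial in \<open>X\<close>, so it preserves every
  \<open>X\<close>-invariant submodule too; this gives equality of \<open>S\<close> and its
  image.\<close>

lemma unipotent_poly_act:
  assumes X: "module_hom s s X" and nil: "X ^^ n = (\<lambda>v. 0)" and p: "coeff p 0 = 1"
  shows bij_unipotent_poly_act: "bij (poly_act s X p)"
    and unipotent_poly_act_image:
      "\<And>S. module.subspace s S \<Longrightarrow> X ` S \<subseteq> S \<Longrightarrow> poly_act s X p ` S = S"
proof -
  obtain q where q: "[:0, 1:] ^ n dvd q * p - 1"
    using unipotent_poly_inverse_mod [OF p] by blast
  have "poly_act s X (q * p) v = v" "poly_act s X (p * q) v = v" for v
    using poly_act_cong_mod [OF X nil q] by (simp_all add: poly_act_1 [OF X] mult.commute)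
  then have inv: "poly_act s X q (poly_act s X p v) = v" "poly_act s X p (poly_act s X q v) = v" for v
    by (simp_all add: poly_act_mult [OF X])
  show "bij (poly_act s X p)"
    by (rule o_bij [of "poly_act s X q"]) (simp_all add: fun_eq_iff inv)
  fix S assume S: "module.subspace s S" "X ` S \<subseteq> S"
  show "poly_act s X p ` S = S"
  proof
    show "S \<subseteq> poly_act s X p ` S"
      using poly_act_in_subspace [OF X S, of _ q] inv(2) by (intro subsetI) (metis imageI)
  qed (use poly_act_in_subspace [OF X S, of _ p] in auto)
qed

section \<open>Flags and the exponential chart\<close>

lemma flag_at_0 [simp]: "flag_at f 0 = {0}"
  by (simp add: flag_at_def)

lemma flag_at_act:
  assumes "g 0 = 0" "i \<le> length f"
  shows "flag_at (flag_act g f) i = g ` flag_at f i"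
  using assms by (cases i) (simp_all add: flag_at_def flag_act_def)

lemma is_flag_length: "is_flag s k f \<Longrightarrow> length f = k"
  by (simp add: is_flag_def)

lemma flag_at_full: "is_flag s k f \<Longrightarrow> flag_at f k = UNIV"
  by (simp add: is_flag_def)

lemma flag_eqI:
  assumes "is_flag s k f" "is_flag s k h" "\<And>i. i \<le> k \<Longrightarrow> flag_at f i = flag_at h i"
  shows "f = h"
proof (rule nth_equalityI)
  show "f ! i = h ! i" if "i < length f" for i
    using assms(3) [of "Suc i"] that is_flag_length [OF assms(1)] by (simp add: flag_at_def)
qed (use assms is_flag_length in metis)

lemma flag_at_mono:
  assumes "is_flag s k f" "i \<le> j" "j \<le> k"
  shows "flag_at f i \<subseteq> flag_at f j"
  using assms(2,3)
proof (induction j rule: dec_induct)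
  case (step n)
  have "flag_at f n \<subseteq> flag_at f (Suc n)"
    using assms(1) step.prems by (simp add: is_flag_def psubset_imp_subset)
  with step show ?case by auto
qed simp

lemma (in module) subspace_flag_at:
  assumes "is_flag scale k f" "i \<le> k"
  shows "subspace (flag_at f i)"
proof (cases "i = 0")
  case False
  then have "i \<in> {1..k}"
    using assms(2) by auto
  then show ?thesis
    using assms(1) unfolding is_flag_def by blast
qed simp

section \<open>Direct sums and transversality\<close>

lemma flag_transvD:
  assumes "is_flag s k f'" "flag_transv k f f'" "i \<le> k"
  shows "direct_sum_decomp (flag_at f i) (flag_at f' (k - i))"
\<comment> \<open>\<open>flag_transv\<close> starts at index 1; at index 0 the decomposition is 0
  \<oplus> m.\<close>
proof (cases "i = 0")
  case True
  then show ?thesis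
    using flag_at_full [OF assms(1)] by (simp add: direct_sum_decomp_def)
qed (use assms in \<open>simp add: flag_transv_def\<close>)

lemma direct_sum_decomp_iff:
  "direct_sum_decomp A B \<longleftrightarrow> (\<forall>v. \<exists>a\<in>A. \<exists>b\<in>B. v = a + b) \<and> A \<inter> B = {0}"
proof -
  have "{a + b |a b. a \<in> A \<and> b \<in> B} = UNIV \<longleftrightarrow> (\<forall>v. \<exists>a\<in>A. \<exists>b\<in>B. v = a + b)"
    by (simp only: set_eq_iff UNIV_I mem_Collect_eq Bex_def simp_thms) metis
  then show ?thesis
    by (simp only: direct_sum_decomp_def)
qed

lemma direct_sum_decomp_commute:
  assumes "direct_sum_decomp A B"
  shows "direct_sum_decomp B A"
proof -
  have "\<exists>b\<in>B. \<exists>a\<in>A. v = b + a" for v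
  proof -
    obtain a b where "a \<in> A" "b \<in> B" "v = a + b"
      using assms unfolding direct_sum_decomp_iff by blast
    then show ?thesis
      using add.commute [of a b] by blast
  qed
  with assms show ?thesis
    by (simp add: direct_sum_decomp_iff Int_commute)
qed

lemma flag_transv_sym:
  assumes "is_flag s k f'" "flag_transv k f f'"
  shows "flag_transv k f' f"
  unfolding flag_transv_def
proof
  fix i assume "i \<in> {1..k}"
  then show "direct_sum_decomp (flag_at f' i) (flag_at f (k - i))"
    using direct_sum_decomp_commute [OF flag_transvD [OF assms, of "k - i"]] by simp
qed

lemma direct_sum_decomp_image:
  assumes "module_hom s s g" "bij g" "direct_sum_decomp A B"
  shows "direct_sum_decomp (g ` A) (g ` B)"
proof -
  interpret module_hom s s g by fact
  have sum: "\<exists>a\<in>A. \<exists>b\<in>B. v = a + b" for v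
    using assms(3) by (simp add: direct_sum_decomp_iff)
  have "A \<inter> B = {0}"
    using assms(3) by (simp add: direct_sum_decomp_iff)
  then have "g ` A \<inter> g ` B = {0}"
    by (simp add: zero image_Int [OF bij_is_inj [OF assms(2)], symmetric])
  moreover have "\<exists>a\<in>g ` A. \<exists>b\<in>g ` B. v = a + b" for v
  proof -
    obtain w where w: "v = g w"
      using assms(2) by (meson bij_pointE)
    obtain a b where "a \<in> A" "b \<in> B" "w = a + b"
      using sum by blast
    with w show ?thesis
      by (auto simp: add)
  qed
  ultimately show ?thesis
    by (simp add: direct_sum_decomp_iff)
qed

section \<open>The nilpotent endomorphisms attached to a flag and their exponentials\<close>

lemma flag_nilI:
  assumes "module_hom s s X" and "\<And>i v. i < k \<Longrightarrow> v \<in> flag_at f (Suc i) \<Longrightarrow> X v \<in> flag_at f i"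
  shows "X \<in> flag_nil s k f"
proof -
  have "X ` flag_at f i \<subseteq> flag_at f (i - 1)" if "i \<in> {1..k}" for i
  proof -
    have "i - 1 < k" "Suc (i - 1) = i"
      using that by auto
    then show ?thesis
      using assms(2) [of "i - 1"] by (intro image_subsetI) simp
  qed
  with assms(1) show ?thesis
    by (simp add: flag_nil_def)
qed

lemma flag_nilD:
  assumes "X \<in> flag_nil s k f"
  shows "module_hom s s X" and "\<And>i v. i < k \<Longrightarrow> v \<in> flag_at f (Suc i) \<Longrightarrow> X v \<in> flag_at f i"
proof -
  show "X v \<in> flag_at f i" if "i < k" "v \<in> flag_at f (Suc i)" for i v
  proof -
    have "Suc i \<in> {1..k}"
      using that(1) by simp
    then have "X ` flag_at f (Suc i) \<subseteq> flag_at f (Suc i - 1)"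
      using assms unfolding flag_nil_def by blast
    with that(2) show ?thesis by auto
  qed
qed (use assms in \<open>simp add: flag_nil_def\<close>)

lemma flag_nil_image_subset:
  assumes f: "is_flag s k f" and X: "X \<in> flag_nil s k f" and "i \<le> k"
  shows "X ` flag_at f i \<subseteq> flag_at f i"
proof (cases i)
  case 0
  then show ?thesis
    using module_hom.zero [OF flag_nilD(1) [OF X]] by simp
next
  case (Suc j)
  then show ?thesis
    using flag_nilD(2) [OF X, of j] flag_at_mono [OF f, of j i] \<open>i \<le> k\<close> by auto
qed

text \<open>Each application of \<open>X\<close> lowers the filtration by one step, from f_k = m
  down to f_0 = 0.\<close>

lemma flag_nil_nilpotent:
  assumes f: "is_flag s k f" and X: "X \<in> flag_nil s k f"
  shows "X ^^ k = (\<lambda>v. 0)"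
proof
  fix v
  have "i \<le> k \<Longrightarrow> (X ^^ i) v \<in> flag_at f (k - i)" for i
  proof (induction i)
    case (Suc i)
    then show ?case
      using flag_nilD(2) [OF X, of "k - Suc i" "(X ^^ i) v"] by (simp add: Suc_diff_Suc)
  qed (simp add: flag_at_full [OF f])
  from this [of k] show "(X ^^ k) v = 0" by simp
qed

text \<open>Write p = q x: \<open>X\<close> lowers the filtration by one step, and q(X) preserves
  each member of the flag.\<close>

lemma flag_nil_poly_act:
  assumes f: "is_flag s k f" and X: "X \<in> flag_nil s k f" and p: "coeff p 0 = 0"
  shows "poly_act s X p \<in> flag_nil s k f"
proof -
  note hX = flag_nilD(1) [OF X]
  interpret module_hom s s X by (fact hX)
  obtain q where "p = [:0, 1:] * q"
    using p unfolding X_dvd_iff_coeff_0 [symmetric] by (elim dvdE)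
  then have q: "p = q * [:0, 1:]"
    by (simp only: mult.commute)
  have "poly_act s X p v \<in> flag_at f i" if "i < k" "v \<in> flag_at f (Suc i)" for i v
    unfolding q poly_act_mult [OF hX] poly_act_X [OF hX]
  proof (rule poly_act_in_subspace [OF hX])
    show "m1.subspace (flag_at f i)" "X ` flag_at f i \<subseteq> flag_at f i"
      using m1.subspace_flag_at [OF f] flag_nil_image_subset [OF f X] that(1) by (meson less_imp_le)+
    show "X v \<in> flag_at f i"
      by (rule flag_nilD(2) [OF X that])
  qed
  then show ?thesis
    by (rule flag_nilI [OF module_hom_poly_act [OF hX]])
qed

text \<open>\<open>exp_poly k\<close> has constant term 1, so exp(X) is unipotent, and exp(X) - 1
  lies in \<open>flag_nil s k f\<close> again.\<close>

lemma trunc_exp_flag_nil: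
  fixes s :: "'a::comm_ring_1 \<Rightarrow> 'm::ab_group_add \<Rightarrow> 'm"
  assumes k: "k \<ge> 2" and f: "is_flag s k f" and X: "X \<in> flag_nil s k f"
  shows module_hom_trunc_exp: "module_hom s s (trunc_exp s k X)"
    and bij_trunc_exp: "bij (trunc_exp s k X)"
    and trunc_exp_image:
      "\<And>S. module.subspace s S \<Longrightarrow> X ` S \<subseteq> S \<Longrightarrow> trunc_exp s k X ` S = S"
    and trunc_exp_diff:
      "\<And>i v. i < k \<Longrightarrow> v \<in> flag_at f (Suc i) \<Longrightarrow> trunc_exp s k X v - v \<in> flag_at f i"
proof -
  note hX = flag_nilD(1) [OF X]
  note eq = trunc_exp_conv_poly_act [OF hX, of k]
  obtain u :: "'a poly" where u: "exp_poly k - 1 = [:0, 1:] * u"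
    using exp_poly_eq [OF k] by blast
  have 0: "coeff (exp_poly k - 1 :: 'a poly) 0 = 0"
    unfolding u by simp
  then have 1: "coeff (exp_poly k :: 'a poly) 0 = 1"
    by simp
  note nil = flag_nil_nilpotent [OF f X]
  show "module_hom s s (trunc_exp s k X)"
    unfolding eq by (rule module_hom_poly_act [OF hX])
  show "bij (trunc_exp s k X)"
    unfolding eq by (rule bij_unipotent_poly_act [OF hX nil 1])
  show "trunc_exp s k X ` S = S" if "module.subspace s S" "X ` S \<subseteq> S" for S
    unfolding eq by (rule unipotent_poly_act_image [OF hX nil 1 that])
  show "trunc_exp s k X v - v \<in> flag_at f i" if "i < k" "v \<in> flag_at f (Suc i)" for i v
    using flag_nilD(2) [OF flag_nil_poly_act [OF f X 0] that]
    by (simp add: eq poly_act_diff [OF hX] poly_act_1 [OF hX])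
qed

lemma flag_at_chart:
  assumes k: "k \<ge> 2" and f: "is_flag s k f" and X: "X \<in> flag_nil s k f"
    and e: "is_flag s k e" and "i \<le> k"
  shows "flag_at (flag_chart s k e X) i = trunc_exp s k X ` flag_at e i"
  unfolding flag_chart_def
  using module_hom.zero [OF module_hom_trunc_exp [OF k f X]] is_flag_length [OF e] \<open>i \<le> k\<close>
  by (intro flag_at_act) auto

lemma is_flag_chart:
  assumes k: "k \<ge> 2" and f: "is_flag s k f" and X: "X \<in> flag_nil s k f"
    and e: "is_flag s k e"
  shows "is_flag s k (flag_chart s k e X)"
proof -
  note g = module_hom_trunc_exp [OF k f X] and b = bij_trunc_exp [OF k f X]
  interpret module_hom s s "trunc_exp s k X" by (fact g)
  have len: "length (flag_chart s k e X) = k"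
    using is_flag_length [OF e] by (simp add: flag_chart_def flag_act_def)
  show ?thesis
    unfolding is_flag_def
  proof (intro conjI ballI allI impI)
    show "length (flag_chart s k e X) = k"
      by (rule len)
    show "m1.subspace (flag_at (flag_chart s k e X) i)" if "i \<in> {1..k}" for i
      using that by (simp add: flag_at_chart [OF assms] subspace_image m1.subspace_flag_at [OF e])
    show "flag_at (flag_chart s k e X) i \<subset> flag_at (flag_chart s k e X) (Suc i)" if "i < k" for i
    proof -
      have "flag_at e i \<subset> flag_at e (Suc i)"
        using e that by (simp add: is_flag_def)
      then show ?thesis
        using that by (simp add: flag_at_chart [OF assms] image_strict_mono [OF inj_on_subset [OF bij_is_inj [OF b]]])
    qed
    show "flag_at (flag_chart s k e X) k = UNIV"
      using bij_is_surj [OF b] by (simp add: flag_at_chart [OF assms] flag_at_full [OF e])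
  qed
qed

text \<open>exp(X) is bijective and maps each f_(k-i) onto itself, so it carries a complement of
  f_(k-i) to a complement.\<close>

lemma flag_transv_chart:
  assumes k: "k \<ge> 2" and f: "is_flag s k f" and X: "X \<in> flag_nil s k f"
    and e: "is_flag s k e" and ef: "flag_transv k e f"
  shows "flag_transv k (flag_chart s k e X) f"
  unfolding flag_transv_def
proof
  fix i assume i: "i \<in> {1..k}"
  interpret module_hom s s X by (fact flag_nilD(1) [OF X])
  have "trunc_exp s k X ` flag_at f (k - i) = flag_at f (k - i)"
    using trunc_exp_image [OF k f X m1.subspace_flag_at [OF f] flag_nil_image_subset [OF f X]] by simp
  then show "direct_sum_decomp (flag_at (flag_chart s k e X) i) (flag_at f (k - i))"
    using direct_sum_decomp_image [OF module_hom_trunc_exp [OF k f X] bij_trunc_exp [OF k f X]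
        flag_transvD [OF f ef, of i]] i
    by (simp add: flag_at_chart [OF k f X e])
qed

text \<open>In the chart centred at \<open>e\<close> the inclusions defining
  \<open>flags_around\<close> become a condition closed under sums and scalars.\<close>

lemma chart_around_iff_invariant:
  fixes s :: "'k::comm_ring_1 \<Rightarrow> 'm::ab_group_add \<Rightarrow> 'm"
  assumes k: "k \<ge> 2" and f: "is_flag s k f" and X: "X \<in> flag_nil s k f"
    and e: "is_flag s k e" and ef: "flag_transv k e f"
    and E: "module.subspace s E" and j: "j < k"
    and eE: "flag_at e j \<subseteq> E" "E \<subseteq> flag_at e (Suc j)"
  defines "h \<equiv> flag_chart s k e X"
  shows "flag_at h j \<subseteq> E \<and> E \<subseteq> flag_at h (Suc j) \<longleftrightarrow> X ` E \<subseteq> E"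
proof -
  define g where "g = trunc_exp s k X"
  note hX = flag_nilD(1) [OF X]
  interpret X: module_hom s s X by (fact hX)
  interpret g: module_hom s s g unfolding g_def by (rule module_hom_trunc_exp [OF k f X])
  have bij: "bij g"
    unfolding g_def by (rule bij_trunc_exp [OF k f X])
  have h: "flag_at h i = g ` flag_at e i" if "i \<le> k" for i
    unfolding h_def g_def by (rule flag_at_chart [OF k f X e that])
  have hj: "flag_at h j = g ` flag_at e j" "flag_at h (Suc j) = g ` flag_at e (Suc j)"
    using h j by simp_all
  show ?thesis
  proof
    assume "X ` E \<subseteq> E"
    then have "g ` E = E"
      unfolding g_def by (rule trunc_exp_image [OF k f X E])
    then show "flag_at h j \<subseteq> E \<and> E \<subseteq> flag_at h (Suc j)"
      unfolding hj using image_mono [OF eE(1), of g] image_mono [OF eE(2), of g] by simp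
  next
    assume hE: "flag_at h j \<subseteq> E \<and> E \<subseteq> flag_at h (Suc j)"
    \<comment> \<open>With u = g w and w in e_(j+1), also w lies in f_(k-j), since \<open>g\<close>
      maps f_(k-j) onto itself. Then g w - w lies both in f_(k-j-1) and in e_(j+1), whose
      intersection is 0.\<close>
    have g_fix: "g u = u" if u: "u \<in> E" "u \<in> flag_at f (k - j)" for u
    proof -
      obtain w where w: "w \<in> flag_at e (Suc j)" "u = g w"
        using u(1) hE hj by blast
      have "g ` flag_at f (k - j) = flag_at f (k - j)"
        unfolding g_def
        by (rule trunc_exp_image [OF k f X X.m1.subspace_flag_at [OF f] flag_nil_image_subset [OF f X]]) simp_all
      then have "w \<in> flag_at f (k - j)"
        using u(2) inj_image_mem_iff [OF bij_is_inj [OF bij]] w(2) by blast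
      then have "g w - w \<in> flag_at f (k - Suc j)"
        unfolding g_def using trunc_exp_diff [OF k f X, of "k - Suc j" w] j by (simp add: Suc_diff_Suc)
      moreover have "u - w \<in> flag_at e (Suc j)"
        using u(1) eE(2) w(1) X.m1.subspace_diff [OF X.m1.subspace_flag_at [OF e]] j
        by (meson Suc_leI subsetD)
      moreover have "flag_at e (Suc j) \<inter> flag_at f (k - Suc j) = {0}"
        using flag_transvD [OF f ef, of "Suc j"] j by (simp add: direct_sum_decomp_iff)
      ultimately have "u - w = 0"
        unfolding w(2) by blast
      then show ?thesis
        using w(2) by simp
    qed
    \<comment> \<open>By the modular law, E is the sum of e_j and E \<inter> f_(k-j), because e_j
      \<subseteq> E.\<close>
    have gE: "g v \<in> E" if v: "v \<in> E" for v
    proof -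
      have "direct_sum_decomp (flag_at e j) (flag_at f (k - j))"
        using flag_transvD [OF f ef, of j] j by simp
      then obtain a u where a: "a \<in> flag_at e j" "u \<in> flag_at f (k - j)" "v = a + u"
        unfolding direct_sum_decomp_iff by blast
      have "u = v - a"
        using a(3) by simp
      then have u: "u \<in> E"
        using X.m1.subspace_diff [OF E v] a(1) eE(1) by blast
      have "g a \<in> E"
        using a(1) hE hj(1) by blast
      then show ?thesis
        unfolding a(3) g.add g_fix [OF u a(2)] using u by (rule X.m1.subspace_add [OF E])
    qed
    obtain u :: "'k poly" where u: "exp_poly k - 1 = [:0, 1:] * u" "coeff u 0 = 1"
      using exp_poly_eq [OF k] by blast
    \<comment> \<open>\<open>p\<close> acts as log(1 + x) modulo x^k, so it recovers
      \<open>X\<close> from \<open>Q\<close>, which is g - 1.\<close>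
    obtain p :: "'k poly" where p: "[:0, 1:] ^ k dvd pcompose p (exp_poly k - 1) - [:0, 1:]"
      using poly_left_compositional_inverse_mod [OF u] by blast
    define Q where "Q = poly_act s X (exp_poly k - 1)"
    have hQ: "module_hom s s Q"
      unfolding Q_def by (rule module_hom_poly_act [OF hX])
    have "Q v = g v - v" for v
      by (simp add: Q_def g_def trunc_exp_conv_poly_act [OF hX] poly_act_diff [OF hX] poly_act_1 [OF hX])
    then have "Q ` E \<subseteq> E"
      using gE X.m1.subspace_diff [OF E] by (simp add: image_subset_iff)
    moreover have "X v = poly_act s Q p v" for v
      unfolding Q_def poly_act_pcompose [OF hX, symmetric]
        poly_act_cong_mod [OF hX flag_nil_nilpotent [OF f X] p] poly_act_X [OF hX] ..
    ultimately show "X ` E \<subseteq> E"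
      using poly_act_in_subspace [OF hQ E] by (simp add: image_subset_iff)
  qed
qed

section \<open>Surjectivity of the chart\<close>

text \<open>When m = A \<oplus> B, these conditions determine \<open>P\<close>: it is the identity
  on \<open>A\<close> and vanishes on \<open>B\<close>.\<close>

definition projection_along ::
    "('k::comm_ring_1 \<Rightarrow> 'm::ab_group_add \<Rightarrow> 'm) \<Rightarrow> 'm set \<Rightarrow> 'm set \<Rightarrow> ('m \<Rightarrow> 'm) \<Rightarrow> bool" where
  "projection_along s A B P \<longleftrightarrow> module_hom s s P \<and> (\<forall>v. P v \<in> A) \<and> (\<forall>v. v - P v \<in> B)"

context
  fixes s :: "'k::comm_ring_1 \<Rightarrow> 'm::ab_group_add \<Rightarrow> 'm" and A B :: "'m set"
  assumes s: "module s" and A: "module.subspace s A" and B: "module.subspace s B"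
    and AB: "direct_sum_decomp A B"
begin

interpretation module s by (fact s)

lemma direct_sum_decomp_eqI:
  assumes "a \<in> A" "a' \<in> A" "v - a \<in> B" "v - a' \<in> B"
  shows "a = a'"
proof -
  have "(v - a') - (v - a) \<in> B"
    by (rule subspace_diff [OF B assms(4,3)])
  then have "a - a' \<in> A \<inter> B"
    using subspace_diff [OF A assms(1,2)] by simp
  then have "a - a' = 0"
    using AB unfolding direct_sum_decomp_def by blast
  then show ?thesis
    by simp
qed

text \<open>Components are chosen pointwise; their uniqueness forces linearity.\<close>

lemma projection_along_exists: "\<exists>P. projection_along s A B P"
proof -
  have "\<exists>a. a \<in> A \<and> v - a \<in> B" for v
  proof -
    obtain a b where "a \<in> A" "b \<in> B" "v = a + b"
      using AB unfolding direct_sum_decomp_iff by blast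
    then show ?thesis
      by (intro exI [of _ a]) simp
  qed
  then obtain P where P: "\<And>v. P v \<in> A" "\<And>v. v - P v \<in> B"
    by metis
  have "P (v + w) = P v + P w" for v w
  proof (rule direct_sum_decomp_eqI [OF P(1) _ P(2)])
    show "v + w - (P v + P w) \<in> B"
      using subspace_add [OF B P(2) P(2), of v w] by (simp add: algebra_simps)
  qed (rule subspace_add [OF A P(1) P(1)])
  moreover have "P (s c v) = s c (P v)" for c v
  proof (rule direct_sum_decomp_eqI [OF P(1) _ P(2)])
    show "s c v - s c (P v) \<in> B"
      using subspace_scale [OF B P(2), of c v] by (simp add: scale_right_diff_distrib)
  qed (rule subspace_scale [OF A P(1)])
  ultimately have "module_hom s s P"
    by unfold_locales
  with P show ?thesis
    unfolding projection_along_def by blast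
qed

lemma projection_along_range: "projection_along s A B P \<Longrightarrow> v \<in> A \<Longrightarrow> P v = v"
  unfolding projection_along_def
  by (rule direct_sum_decomp_eqI [of _ _ v]) (simp_all add: subspace_0 [OF B])

lemma projection_along_kernel: "projection_along s A B P \<Longrightarrow> v \<in> B \<Longrightarrow> P v = 0"
  unfolding projection_along_def
  by (rule direct_sum_decomp_eqI [of _ _ v]) (simp_all add: subspace_0 [OF A])

text \<open>For \<open>v\<close> in \<open>A\<close>, its component in \<open>A'\<close> along
  \<open>B\<close> is also its component in \<open>A\<close>, hence \<open>v\<close> itself.\<close>

lemma direct_sum_decomp_subset_eq:
  assumes "A' \<subseteq> A" "direct_sum_decomp A' B"
  shows "A' = A"
proof
  show "A \<subseteq> A'"
  proof
    fix v assume v: "v \<in> A"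
    obtain a b where ab: "a \<in> A'" "b \<in> B" "v = a + b"
      using assms(2) unfolding direct_sum_decomp_iff by blast
    then have "v = a"
      using v assms(1) subspace_0 [OF B] by (intro direct_sum_decomp_eqI [of _ _ v]) auto
    with ab show "v \<in> A'" by simp
  qed
qed (fact assms)

end

text \<open>Guarantees that \<open>flag_coord\<close> really yields a preimage under the
  chart.\<close>

lemma flag_chart_surj:
  fixes s :: "'k::comm_ring_1 \<Rightarrow> 'm::ab_group_add \<Rightarrow> 'm"
  assumes s: "module s" and k: "k \<ge> 2" and f: "is_flag s k f"
    and e: "is_flag s k e" and ef: "flag_transv k e f"
    and h: "is_flag s k h" and hf: "flag_transv k h f"
  shows "\<exists>X\<in>flag_nil s k f. flag_chart s k e X = h"
proof -
  interpret module s by fact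
  note sub = subspace_flag_at
  have proj: "\<exists>P. \<forall>i\<le>k. projection_along s (flag_at e i) (flag_at f (k - i)) (P i)"
    if e: "is_flag s k e" "flag_transv k e f" for e
  proof -
    have "\<exists>P. projection_along s (flag_at e i) (flag_at f (k - i)) P" if "i \<le> k" for i
      by (rule projection_along_exists [OF s sub [OF e(1) that] sub [OF f] flag_transvD [OF f e(2) that]]) simp
    then show ?thesis by metis
  qed
  obtain P where P: "\<And>i. i \<le> k \<Longrightarrow> projection_along s (flag_at e i) (flag_at f (k - i)) (P i)"
    using proj [OF e ef] by blast
  obtain P' where P': "\<And>i. i \<le> k \<Longrightarrow> projection_along s (flag_at h i) (flag_at f (k - i)) (P' i)"
    using proj [OF h hf] by blast
  have P_id: "P i v = v" if "i \<le> k" "v \<in> flag_at e i" for i v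
    by (rule projection_along_range [OF s sub [OF e that(1)] sub [OF f] flag_transvD [OF f ef that(1)] P [OF that(1)] that(2)]) simp
  have P_0: "P i v = 0" if "i \<le> k" "v \<in> flag_at f (k - i)" for i v
    by (rule projection_along_kernel [OF s sub [OF e that(1)] sub [OF f] flag_transvD [OF f ef that(1)] P [OF that(1)] that(2)]) simp
  have P'_zero: "P' i 0 = 0" if "i \<le> k" for i
    using P' [OF that] unfolding projection_along_def by (metis module_hom.zero)
  \<comment> \<open>\<open>D m v\<close> is the component of \<open>v\<close> in the intersection of
    e_(m+1) and f_(k-m); the components sum to \<open>v\<close> by telescoping. \<open>N\<close> is
    g - 1 for the map g that applies \<open>P' (Suc m)\<close> to the component of index
    \<open>m\<close>.\<close>
  define D where "D m v = P (Suc m) v - P m v" for m v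
  define N where "N v = (\<Sum>m<k. P' (Suc m) (D m v) - D m v)" for v
  have sum_D: "(\<Sum>m<k. D m v) = v" for v
    using sum_lessThan_telescope [of "\<lambda>m. P m v" k] P_id [of k v] P_0 [of 0 v]
    by (simp add: D_def flag_at_full [OF e] flag_at_full [OF f])
  have hN: "module_hom s s N"
  proof -
    interpret module_pair s s by unfold_locales
    have hP: "module_hom s s (P i)" and hP': "module_hom s s (P' i)" if "i \<le> k" for i
      using P [OF that] P' [OF that] by (simp_all add: projection_along_def)
    have "module_hom s s (\<lambda>v. P' (Suc m) (D m v) - D m v)" if "m < k" for m
    proof (rule module_hom_sub)
      show hD: "module_hom s s (D m)"
        unfolding D_def [abs_def] by (rule module_hom_sub [OF hP hP]) (use that in simp_all)
      show "module_hom s s (\<lambda>v. P' (Suc m) (D m v))"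
        using module_hom_compose [OF hD hP' [of "Suc m"]] that by (simp add: comp_def)
    qed
    then show ?thesis
      unfolding N_def using s by (intro module_hom_sum) auto
  qed
  have N: "N \<in> flag_nil s k f"
  proof (rule flag_nilI [OF hN])
    fix i v assume i: "i < k" and v: "v \<in> flag_at f (Suc i)"
    show "N v \<in> flag_at f i"
      unfolding N_def
    proof (rule subspace_sum [OF sub [OF f]])
      fix m assume "m \<in> {..<k}"
      then have m: "m < k" by simp
      show "P' (Suc m) (D m v) - D m v \<in> flag_at f i"
      \<comment> \<open>Either f_(i+1) is contained in both kernels f_(k-m-1) and f_(k-m), so
        \<open>D m v = 0\<close>, or f_(k-m-1), where the difference lies, is contained in
        f_i.\<close>
      proof (cases "Suc m \<le> k - Suc i")
        case True
        then have "Suc i \<le> k - Suc m" "Suc i \<le> k - m"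
          using i by linarith+
        then have "v \<in> flag_at f (k - Suc m)" "v \<in> flag_at f (k - m)"
          using flag_at_mono [OF f, of "Suc i" "k - Suc m"] flag_at_mono [OF f, of "Suc i" "k - m"] v
          by auto
        then have "D m v = 0"
          using P_0 [of m v] P_0 [of "Suc m" v] m by (simp add: D_def)
        then show ?thesis
          using P'_zero [of "Suc m"] m i subspace_0 [OF sub [OF f]] by simp
      next
        case False
        then have "k - Suc m \<le> i"
          by linarith
        then have "D m v - P' (Suc m) (D m v) \<in> flag_at f i"
          using P' [of "Suc m"] m i flag_at_mono [OF f, of "k - Suc m" i]
          unfolding projection_along_def by auto
        then show ?thesis
          using subspace_neg [OF sub [OF f], of i "D m v - P' (Suc m) (D m v)"] i by simp
      qed
    qed (use i in simp)
  qed
  have g_eq: "v + N v = (\<Sum>m<k. P' (Suc m) (D m v))" for v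
    by (simp add: N_def sum_subtractf sum_D)
  \<comment> \<open>For m \<ge> i both projections fix \<open>v\<close>, so
    \<open>D m v = 0\<close>; for m < i the values of \<open>P' (Suc m)\<close> lie in h_(m+1)
    \<subseteq> h_i.\<close>
  have g_image: "v + N v \<in> flag_at h i" if i: "i \<le> k" and v: "v \<in> flag_at e i" for i v
    unfolding g_eq
  proof (rule subspace_sum [OF sub [OF h i]])
    fix m assume "m \<in> {..<k}"
    then have m: "m < k" by simp
    show "P' (Suc m) (D m v) \<in> flag_at h i"
    proof (cases "i \<le> m")
      case True
      then have "v \<in> flag_at e m" "v \<in> flag_at e (Suc m)"
        using flag_at_mono [OF e, of i m] flag_at_mono [OF e, of i "Suc m"] v m by auto
      then have "D m v = 0"
        using P_id [of m v] P_id [of "Suc m" v] m by (simp add: D_def)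
      then show ?thesis
        using P'_zero [of "Suc m"] m subspace_0 [OF sub [OF h i]] by simp
    next
      case False
      then show ?thesis
        using P' [of "Suc m"] m i flag_at_mono [OF h, of "Suc m" i]
        unfolding projection_along_def by auto
    qed
  qed
  obtain u :: "'k poly" where u: "exp_poly k - 1 = [:0, 1:] * u" "coeff u 0 = 1"
    using exp_poly_eq [OF k] by blast
  obtain p :: "'k poly" where p0: "[:0, 1:] dvd p"
    and p: "[:0, 1:] ^ k dvd pcompose (exp_poly k - 1) p - [:0, 1:]"
    using poly_right_compositional_inverse_mod [OF u] by blast
  \<comment> \<open>\<open>X\<close> is the logarithm of 1 + N; divisibility of \<open>p\<close> by
    x keeps it in \<open>flag_nil s k f\<close>.\<close>
  define X where "X = poly_act s N p"
  have X: "X \<in> flag_nil s k f"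
    unfolding X_def using p0 by (intro flag_nil_poly_act [OF f N]) (simp only: X_dvd_iff_coeff_0)
  have "poly_act s N (pcompose (exp_poly k - 1) p) v = N v" for v
    unfolding poly_act_cong_mod [OF hN flag_nil_nilpotent [OF f N] p] poly_act_X [OF hN] ..
  then have exp_X: "trunc_exp s k X v = v + N v" for v
    unfolding X_def trunc_exp_conv_poly_act [OF module_hom_poly_act [OF hN]]
      poly_act_pcompose [OF hN, symmetric]
    by (simp add: pcompose_diff pcompose_1 poly_act_diff [OF hN] poly_act_1 [OF hN] algebra_simps)
  have "flag_chart s k e X = h"
  proof (rule flag_eqI [OF is_flag_chart [OF k f X e] h])
    fix i assume i: "i \<le> k"
    \<comment> \<open>The inclusion suffices, since both sides are complements of f_(k-i).\<close>
    have "flag_at (flag_chart s k e X) i \<subseteq> flag_at h i"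
      using g_image [OF i] by (auto simp: flag_at_chart [OF k f X e i] exp_X)
    then show "flag_at (flag_chart s k e X) i = flag_at h i"
      using flag_transvD [OF f flag_transv_chart [OF k f X e ef] i]
      by (rule direct_sum_decomp_subset_eq [OF s sub [OF h i] sub [OF f] flag_transvD [OF f hf i], rotated]) simp
  qed
  with X show ?thesis by blast
qed

section \<open>Intrinsic subspaces\<close>

lemma submodules_isomorphic_image:
  assumes g: "module_hom s s g" and b: "bij g" and AB: "submodules_isomorphic s A B"
    and A: "module.subspace s A"
  shows "submodules_isomorphic s (g ` A) B"
proof -
  interpret module_hom s s g by (fact g)
  obtain \<phi> where \<phi>: "bij_betw \<phi> A B" "\<And>x y. x \<in> A \<Longrightarrow> y \<in> A \<Longrightarrow> \<phi> (x + y) = \<phi> x + \<phi> y"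
    "\<And>c x. x \<in> A \<Longrightarrow> \<phi> (s c x) = s c (\<phi> x)"
    using AB unfolding submodules_isomorphic_def by blast
  have inv [simp]: "inv g (g x) = x" for x
    using bij_is_inj [OF b] by simp
  have "bij_betw (inv g) (g ` A) A"
    by (rule bij_betw_imageI) (auto simp: inj_on_def image_image)
  then have "bij_betw (\<phi> \<circ> inv g) (g ` A) B"
    using \<phi>(1) by (rule bij_betw_trans)
  moreover have "(\<phi> \<circ> inv g) (g x + g y) = (\<phi> \<circ> inv g) (g x) + (\<phi> \<circ> inv g) (g y)"
    if "x \<in> A" "y \<in> A" for x y
    using \<phi>(2) [OF that] by (simp flip: add)
  moreover have "(\<phi> \<circ> inv g) (s c (g x)) = s c ((\<phi> \<circ> inv g) (g x))" if "x \<in> A" for c x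
    using \<phi>(3) [OF that] by (simp flip: scale)
  ultimately show ?thesis
    unfolding submodules_isomorphic_def by blast
qed

text \<open>exp(X) restricts to isomorphisms from the e_i onto their images; this keeps the chart
  inside a subgeometry.\<close>

lemma same_type_chart:
  assumes k: "k \<ge> 2" and f: "is_flag s k f" and X: "X \<in> flag_nil s k f"
    and e: "is_flag s k e" and "same_type s k e b"
  shows "same_type s k (flag_chart s k e X) b"
  unfolding same_type_def
proof
  fix i assume i: "i \<in> {1..k}"
  interpret module_hom s s X by (fact flag_nilD(1) [OF X])
  have "submodules_isomorphic s (trunc_exp s k X ` flag_at e i) (flag_at b i)"
    using assms(5) i m1.subspace_flag_at [OF e, of i]
    by (intro submodules_isomorphic_image [OF module_hom_trunc_exp [OF k f X] bij_trunc_exp [OF k f X]])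
      (simp_all add: same_type_def)
  then show "submodules_isomorphic s (flag_at (flag_chart s k e X) i) (flag_at b i)"
    using flag_at_chart [OF k f X e, of i] i by simp
qed

text \<open>Treats the full geometry and its subgeometries together; \<open>chart\<close> expresses
  that moving a point by exp(X) stays within the geometry.\<close>

lemma flags_around_intrinsic:
  fixes s :: "'k::comm_ring_1 \<Rightarrow> 'm::ab_group_add \<Rightarrow> 'm"
    and G :: "('k, 'm set list, 'm set list) pair_geometry"
  assumes s: "module s" and k: "k \<ge> 2" and j: "j < k" and E: "module.subspace s E"
    and transv: "transv G = flag_transv k"
    and point_add: "point_add G = flag_add s k" and point_smult: "point_smult G = flag_smult s k"
    and points: "\<And>e. e \<in> points G \<Longrightarrow> is_flag s k e"
    and copoints: "\<And>f. f \<in> copoints G \<Longrightarrow> is_flag s k f"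
    and chart: "\<And>e f X. e \<in> points G \<Longrightarrow> f \<in> copoints G \<Longrightarrow> flag_transv k e f \<Longrightarrow>
      X \<in> flag_nil s k f \<Longrightarrow> flag_chart s k e X \<in> points G"
  shows "intrinsic_subspace G (flags_around G E j)"
proof -
  interpret module s by fact
  interpret module_pair s s by unfold_locales
  define I where "I = flags_around G E j"
  have I: "e \<in> I \<longleftrightarrow> e \<in> points G \<and> flag_at e j \<subseteq> E \<and> E \<subseteq> flag_at e (Suc j)" for e
    by (simp add: I_def flags_around_def)
  have "linear_subspace_at G f e (affine_part G f \<inter> I)"
    if f: "f \<in> copoints G" and e: "e \<in> affine_part G f \<inter> I" for f e
  proof -
    define S where "S = affine_part G f \<inter> I"
    \<comment> \<open>\<open>U\<close> is the linear model of \<open>S\<close>: a submodule of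
      \<open>flag_nil s k f\<close> that the chart maps onto \<open>S\<close>.\<close>
    define U where "U = {X \<in> flag_nil s k f. X ` E \<subseteq> E}"
    note flag_f = copoints [OF f]
    have ef: "e \<in> points G" "flag_transv k e f" "flag_at e j \<subseteq> E" "E \<subseteq> flag_at e (Suc j)"
      using e by (auto simp: affine_part_def transv I)
    note flag_e = points [OF ef(1)]
    have chart_in_S: "flag_chart s k e X \<in> S \<longleftrightarrow> X \<in> U" if X: "X \<in> flag_nil s k f" for X
      using chart_around_iff_invariant [OF k flag_f X flag_e ef(2) E j ef(3,4)]
        chart [OF ef(1) f ef(2) X] flag_transv_chart [OF k flag_f X flag_e ef(2)] X
      by (simp add: S_def affine_part_def transv I U_def)
    have coord: "flag_coord s k f e h \<in> U" if h: "h \<in> S" for h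
    proof -
      have "is_flag s k h" "flag_transv k h f"
        using h points by (auto simp: S_def affine_part_def transv)
      then have "h \<in> flag_chart s k e ` flag_nil s k f"
        using flag_chart_surj [OF s k flag_f flag_e ef(2)] by blast
      then have "flag_coord s k f e h \<in> flag_nil s k f"
        "flag_chart s k e (flag_coord s k f e h) = h"
        unfolding flag_coord_def by (rule inv_into_into, rule f_inv_into_f)
      then show ?thesis
        using chart_in_S h by metis
    qed
    have U_add: "(\<lambda>v. X v + Y v) \<in> U" if "X \<in> U" "Y \<in> U" for X Y
    proof -
      have XY: "X \<in> flag_nil s k f" "Y \<in> flag_nil s k f" "X ` E \<subseteq> E" "Y ` E \<subseteq> E"
        using that by (simp_all add: U_def)
      have "(\<lambda>v. X v + Y v) \<in> flag_nil s k f"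
      proof (rule flag_nilI)
        show "module_hom s s (\<lambda>v. X v + Y v)"
          by (rule module_hom_add [OF flag_nilD(1) [OF XY(1)] flag_nilD(1) [OF XY(2)]])
        show "X v + Y v \<in> flag_at f i" if "i < k" "v \<in> flag_at f (Suc i)" for i v
          using that(1)
          by (intro subspace_add [OF subspace_flag_at [OF flag_f]]
              flag_nilD(2) [OF XY(1) that] flag_nilD(2) [OF XY(2) that]) simp
      qed
      moreover have "X v + Y v \<in> E" if "v \<in> E" for v
        using that XY(3,4) by (intro subspace_add [OF E]) auto
      ultimately show ?thesis
        by (auto simp: U_def)
    qed
    have U_scale: "(\<lambda>v. s c (X v)) \<in> U" if "X \<in> U" for c X
    proof -
      have X: "X \<in> flag_nil s k f" "X ` E \<subseteq> E"
        using that by (simp_all add: U_def)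
      have "(\<lambda>v. s c (X v)) \<in> flag_nil s k f"
      proof (rule flag_nilI)
        show "module_hom s s (\<lambda>v. s c (X v))"
          by (rule module_hom_scale [OF flag_nilD(1) [OF X(1)]])
        show "s c (X v) \<in> flag_at f i" if "i < k" "v \<in> flag_at f (Suc i)" for i v
          using that(1)
          by (intro subspace_scale [OF subspace_flag_at [OF flag_f]] flag_nilD(2) [OF X(1) that]) simp
      qed
      moreover have "s c (X v) \<in> E" if "v \<in> E" for v
        using that X(2) by (intro subspace_scale [OF E]) auto
      ultimately show ?thesis
        by (auto simp: U_def)
    qed
    have U_nil: "X \<in> flag_nil s k f" if "X \<in> U" for X
      using that by (simp add: U_def)
    have "flag_add s k f e g h \<in> S" if "g \<in> S" "h \<in> S" for g h
      using U_add [OF coord coord, OF that] chart_in_S [OF U_nil] by (simp add: flag_add_def)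
    moreover have "flag_smult s k f e c h \<in> S" if "h \<in> S" for c h
      using U_scale [OF coord, OF that] chart_in_S [OF U_nil] by (simp add: flag_smult_def)
    ultimately show ?thesis
      using e unfolding S_def [symmetric]
      by (simp add: linear_subspace_at_def point_add point_smult) (simp add: S_def)
  qed
  moreover have "I \<subseteq> points G"
    using I by blast
  ultimately show ?thesis
    unfolding intrinsic_subspace_def I_def [symmetric] by blast
qed

theorem theorem3p8:
  fixes s :: "'k::comm_ring_1 \<Rightarrow> 'm::ab_group_add \<Rightarrow> 'm"
    and k j :: nat
    and E :: "'m set"
    and G :: "('k, 'm set list, 'm set list) pair_geometry"
  assumes "module s"
    and "(2::'k) dvd 1"
    and "k \<ge> 2"
    and "\<forall>n\<in>{2..k - 1}. (of_nat n :: 'k) dvd 1"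
    and "G = flag_geometry s k \<or>
         (\<exists>b b'. is_flag s k b \<and> is_flag s k b' \<and> flag_transv k b b' \<and>
                 G = flag_subgeometry s k b b')"
    and "j \<in> {0..k - 1}"
    and "module.subspace s E"
  shows "intrinsic_subspace G (flags_around G E j)"
proof -
  note k = \<open>k \<ge> 2\<close>
  have j: "j < k"
    using assms(3,6) by auto
  have flag: "is_flag s k e" if "e \<in> complemented_flags s k" for e
    using that by (simp add: complemented_flags_def)
  have compl: "flag_chart s k e X \<in> complemented_flags s k"
    if "is_flag s k e" "is_flag s k f" "flag_transv k e f" "X \<in> flag_nil s k f" for e f X
    using that is_flag_chart [OF k] flag_transv_chart [OF k] unfolding complemented_flags_def by blast
  show ?thesis
    using assms(5)
  proof
    assume G: "G = flag_geometry s k"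
    show ?thesis
      by (rule flags_around_intrinsic [OF assms(1) k j assms(7)])
        (auto simp: G flag_geometry_def flag intro: compl [OF flag flag])
  next
    assume "\<exists>b b'. is_flag s k b \<and> is_flag s k b' \<and> flag_transv k b b' \<and> G = flag_subgeometry s k b b'"
    then obtain b b' where G: "G = flag_subgeometry s k b b'"
      by blast
    have points: "points G = flags_of_type s k b b'" and copoints: "copoints G = flags_of_type s k b' b"
      by (simp_all add: G flag_subgeometry_def)
    show ?thesis
    proof (rule flags_around_intrinsic [OF assms(1) k j assms(7)])
      fix e f X assume "e \<in> points G" "f \<in> copoints G" and ef: "flag_transv k e f"
        and X: "X \<in> flag_nil s k f"
      then have e: "is_flag s k e" "same_type s k e b" and f: "is_flag s k f" "same_type s k f b'"
        by (auto simp: points copoints flags_of_type_def complemented_flags_def)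
      \<comment> \<open>\<open>f\<close> itself is the transversal flag of type \<open>b'\<close>
        that \<open>flags_of_type\<close> asks for.\<close>
      have "flag_transv k f (flag_chart s k e X)"
        by (rule flag_transv_sym [OF f(1) flag_transv_chart [OF k f(1) X e(1) ef]])
      then show "flag_chart s k e X \<in> points G"
        using compl [OF e(1) f(1) ef X] same_type_chart [OF k f(1) X e] f
        unfolding points flags_of_type_def by blast
    qed (auto simp: points copoints flags_of_type_def complemented_flags_def,
        simp_all add: G flag_subgeometry_def flag_geometry_def)
  qed
qed

end
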